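(* Let $\mathcal{G}$ be a Generalized Probabilistic Cops and Robbers (GPCR) game, and define, for $s\in S$, $$w_0(s) := \begin{cases}1, & \text{if } s\in F,\\ 0, & \text{otherwise,}\end{cases}$$ and, for $n\geq 1$, $$w_n(s) := \begin{cases}1, & \text{if } s\in F,\\ \displaystyle\max_{a\in A_{\mathrm{cop}}(s)} \sum_{s'\in S} T_{\mathrm{cop}}(s,a,s') \min_{a'\in A_{\mathrm{rob}}(s')} \sum_{s''\in S} T_{\mathrm{rob}}(s',a',s'')\, w_{n-1}(s''), & \text{otherwise.}\end{cases}$$ Then $w_n(s)$ gives the probability for the robbers to be captured in $n$ turns or less, given that both players play optimally, starting in state $s$. Thus $w_n(i_0) = p_n^*$. This also says that $\mathcal{G}$ is $p$-copwin in $n$ turns (i.e. $p_n^*\geq p$) if and only if $w_n(i_0)\geq p$. Moreover, for $(s,k)\in S\times\mathbb{N}$, letting $\sigma^*_{\mathrm{cop}}(s,k)$ be an action achieving the $\operatorname{argmax}$ in place of the $\max$ in the recursion defining $w_k(s)$ (the argmax need not be unique) defines finite horizon strategies that are optimal in $\mathcal{G}_n$.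
   Context: A GPCR game is a tuple $\mathcal{G}=(S,i_0,F,A,T_{\mathrm{cop}},T_{\mathrm{rob}})$ played by a cop team and a robber team, where: $S=S_{\mathrm{cop}}\times S_{\mathrm{rob}}\times S_{\mathrm{o}}$ is a non-empty finite set of states (cop positions, robber positions, other information); $i_0\in S$ is the initial state; $F\subseteq S$ is the set of final (winning) states for the cops; $A=A_{\mathrm{cop}}\cup A_{\mathrm{rob}}$ with $A_{\mathrm{cop}},A_{\mathrm{rob}}$ non-empty finite action sets; $T_{\mathrm{cop}}:S\times A_{\mathrm{cop}}\times S\to[0,1]$ satisfies $\sum_{s'\in S}T_{\mathrm{cop}}(s,a,s')\in\{0,1\}$ for all $s,a$, an action being playable in $s$ when the sum is 1, with $A_{\mathrm{cop}}(s)$ the (non-empty) set of actions playable by the cops at $s$, and $T_{\mathrm{cop}}(s,a,s)=1$ for every $s\in F$ and every action $a$; $T_{\mathrm{rob}}$ is a similar transition function for the robbers with playable action sets $A_{\mathrm{rob}}(s)$. A play is an infinite sequence $i_0a_0s_1a_1s_2\dots$ alternating cop moves and robber moves (cops first) with positive transition probabilities; a turn consists of a cop move followed by a robber move; the cops win if a state of $F$ is encountered, otherwise the robbers win. $\mathcal{G}_n$ denotes the game restricted to plays of $n$ complete turns. A finite horizon strategy is a map $S\times\mathbb{N}\to A$ (depending on the current state and the number of turns remaining). $p_n^* := \max_{\sigma_{\mathrm{cop}}}\min_{\sigma_{\mathrm{rob}}} \mathbb{P}(\text{capture in at most } n \text{ steps}\mid\sigma_{\mathrm{cop}},\sigma_{\mathrm{rob}})$,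 the max and min being over finite horizon strategies of the cops and robbers respectively; it is the value of $\mathcal{G}_n$. $\mathcal{G}$ is said to be $p$-copwin in $n$ turns if $p_n^*\geq p$. *)

theory Defs
  imports "HOL-Probability.Probability"
begin

record ('c, 'r, 'o, 'a) gpcr =
  S_cop :: "'c set"
  S_rob :: "'r set"
  S_oth :: "'o set"
  init :: "'c \<times> 'r \<times> 'o"
  final :: "('c \<times> 'r \<times> 'o) set"
  A_cop :: "'a set"
  A_rob :: "'a set"
  T_cop :: "'c \<times> 'r \<times> 'o \<Rightarrow> 'a \<Rightarrow> 'c \<times> 'r \<times> 'o \<Rightarrow> real"
  T_rob :: "'c \<times> 'r \<times> 'o \<Rightarrow> 'a \<Rightarrow> 'c \<times> 'r \<times> 'o \<Rightarrow> real"

definition states :: "('c, 'r, 'o, 'a) gpcr \<Rightarrow> ('c \<times> 'r \<times> 'o) set" where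
  "states G = S_cop G \<times> S_rob G \<times> S_oth G"

definition playable_cop :: "('c, 'r, 'o, 'a) gpcr \<Rightarrow> 'c \<times> 'r \<times> 'o \<Rightarrow> 'a set" where
  "playable_cop G s = {a \<in> A_cop G. (\<Sum>s'\<in>states G. T_cop G s a s') = 1}"

definition playable_rob :: "('c, 'r, 'o, 'a) gpcr \<Rightarrow> 'c \<times> 'r \<times> 'o \<Rightarrow> 'a set" where
  "playable_rob G s = {a \<in> A_rob G. (\<Sum>s'\<in>states G. T_rob G s a s') = 1}"

definition gpcr_game :: "('c, 'r, 'o, 'a) gpcr \<Rightarrow> bool" where
  "gpcr_game G \<longleftrightarrow>
     finite (states G) \<and> states G \<noteq> {} \<and> init G \<in> states G \<and> final G \<subseteq> states G \<and>
     finite (A_cop G) \<and> A_cop G \<noteq> {} \<and> finite (A_rob G) \<and> A_rob G \<noteq> {} \<and>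
     (\<forall>s\<in>states G. \<forall>a\<in>A_cop G. \<forall>s'\<in>states G. T_cop G s a s' \<in> {0..1}) \<and>
     (\<forall>s\<in>states G. \<forall>a\<in>A_cop G. (\<Sum>s'\<in>states G. T_cop G s a s') \<in> {0, 1}) \<and>
     (\<forall>s\<in>states G. playable_cop G s \<noteq> {}) \<and>
     (\<forall>s\<in>final G. \<forall>a\<in>A_cop G. T_cop G s a s = 1) \<and>
     (\<forall>s\<in>states G. \<forall>a\<in>A_rob G. \<forall>s'\<in>states G. T_rob G s a s' \<in> {0..1}) \<and>
     (\<forall>s\<in>states G. \<forall>a\<in>A_rob G. (\<Sum>s'\<in>states G. T_rob G s a s') \<in> {0, 1}) \<and>
     (\<forall>s\<in>states G. playable_rob G s \<noteq> {}) \<and>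
     (\<forall>s\<in>final G. \<forall>a\<in>A_rob G. T_rob G s a s = 1)"

text \<open>A finite horizon strategy maps a state and the number of turns remaining, the current turn
  included, to a playable action. The robbers, who complete the turn begun by the cops, see the same
  number as the cops in that turn. Values outside the state set are unconstrained and never used.\<close>

definition cop_strategies ::
  "('c, 'r, 'o, 'a) gpcr \<Rightarrow> ('c \<times> 'r \<times> 'o \<Rightarrow> nat \<Rightarrow> 'a) set" where
  "cop_strategies G = {\<sigma>. \<forall>s\<in>states G. \<forall>k. \<sigma> s k \<in> playable_cop G s}"

definition rob_strategies ::
  "('c, 'r, 'o, 'a) gpcr \<Rightarrow> ('c \<times> 'r \<times> 'o \<Rightarrow> nat \<Rightarrow> 'a) set" where
  "rob_strategies G = {\<sigma>. \<forall>s\<in>states G. \<forall>k. \<sigma> s k \<in> playable_rob G s}"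

definition cop_move :: "('c, 'r, 'o, 'a) gpcr \<Rightarrow> 'c \<times> 'r \<times> 'o \<Rightarrow> 'a \<Rightarrow> ('c \<times> 'r \<times> 'o) pmf" where
  "cop_move G s a = embed_pmf (\<lambda>s'. if s' \<in> states G then T_cop G s a s' else 0)"

definition rob_move :: "('c, 'r, 'o, 'a) gpcr \<Rightarrow> 'c \<times> 'r \<times> 'o \<Rightarrow> 'a \<Rightarrow> ('c \<times> 'r \<times> 'o) pmf" where
  "rob_move G s a = embed_pmf (\<lambda>s'. if s' \<in> states G then T_rob G s a s' else 0)"

text \<open>Distribution of the plays of \<open>n\<close> complete turns from \<open>s\<close>. The play
  \<open>s a\<^sub>0 s\<^sub>1 a\<^sub>1 s\<^sub>2 \<dots>\<close> is represented by the list \<open>[(a\<^sub>0, s\<^sub>1), (a\<^sub>1, s\<^sub>2), \<dots>]\<close> of length \<open>2n\<close>.\<close>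

primrec plays ::
  "('c, 'r, 'o, 'a) gpcr \<Rightarrow> ('c \<times> 'r \<times> 'o \<Rightarrow> nat \<Rightarrow> 'a) \<Rightarrow> ('c \<times> 'r \<times> 'o \<Rightarrow> nat \<Rightarrow> 'a) \<Rightarrow>
   nat \<Rightarrow> 'c \<times> 'r \<times> 'o \<Rightarrow> ('a \<times> 'c \<times> 'r \<times> 'o) list pmf" where
  "plays G \<sigma> \<tau> 0 s = return_pmf []"
| "plays G \<sigma> \<tau> (Suc n) s =
     bind_pmf (cop_move G s (\<sigma> s (Suc n))) (\<lambda>s'.
     bind_pmf (rob_move G s' (\<tau> s' (Suc n))) (\<lambda>s''.
     map_pmf (\<lambda>h. (\<sigma> s (Suc n), s') # (\<tau> s' (Suc n), s'') # h) (plays G \<sigma> \<tau> n s'')))"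

definition capture_prob ::
  "('c, 'r, 'o, 'a) gpcr \<Rightarrow> ('c \<times> 'r \<times> 'o \<Rightarrow> nat \<Rightarrow> 'a) \<Rightarrow> ('c \<times> 'r \<times> 'o \<Rightarrow> nat \<Rightarrow> 'a) \<Rightarrow>
   nat \<Rightarrow> 'c \<times> 'r \<times> 'o \<Rightarrow> real" where
  "capture_prob G \<sigma> \<tau> n s =
     measure_pmf.prob (plays G \<sigma> \<tau> n s) {h. \<exists>t \<in> insert s (snd ` set h). t \<in> final G}"

definition cop_guarantee ::
  "('c, 'r, 'o, 'a) gpcr \<Rightarrow> nat \<Rightarrow> 'c \<times> 'r \<times> 'o \<Rightarrow> ('c \<times> 'r \<times> 'o \<Rightarrow> nat \<Rightarrow> 'a) \<Rightarrow> real" where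
  "cop_guarantee G n s \<sigma> = Min ((\<lambda>\<tau>. capture_prob G \<sigma> \<tau> n s) ` rob_strategies G)"

definition rob_guarantee ::
  "('c, 'r, 'o, 'a) gpcr \<Rightarrow> nat \<Rightarrow> 'c \<times> 'r \<times> 'o \<Rightarrow> ('c \<times> 'r \<times> 'o \<Rightarrow> nat \<Rightarrow> 'a) \<Rightarrow> real" where
  "rob_guarantee G n s \<tau> = Max ((\<lambda>\<sigma>. capture_prob G \<sigma> \<tau> n s) ` cop_strategies G)"

definition max_min_value :: "('c, 'r, 'o, 'a) gpcr \<Rightarrow> nat \<Rightarrow> 'c \<times> 'r \<times> 'o \<Rightarrow> real" where
  "max_min_value G n s = Max (cop_guarantee G n s ` cop_strategies G)"

definition p_star :: "('c, 'r, 'o, 'a) gpcr \<Rightarrow> nat \<Rightarrow> real" where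
  "p_star G n = max_min_value G n (init G)"

definition copwin :: "('c, 'r, 'o, 'a) gpcr \<Rightarrow> real \<Rightarrow> nat \<Rightarrow> bool" where
  "copwin G p n \<longleftrightarrow> p_star G n \<ge> p"

definition optimal_cop ::
  "('c, 'r, 'o, 'a) gpcr \<Rightarrow> nat \<Rightarrow> 'c \<times> 'r \<times> 'o \<Rightarrow> ('c \<times> 'r \<times> 'o \<Rightarrow> nat \<Rightarrow> 'a) \<Rightarrow> bool" where
  "optimal_cop G n s \<sigma> \<longleftrightarrow>
     \<sigma> \<in> cop_strategies G \<and> cop_guarantee G n s \<sigma> = max_min_value G n s"

definition optimal_rob ::
  "('c, 'r, 'o, 'a) gpcr \<Rightarrow> nat \<Rightarrow> 'c \<times> 'r \<times> 'o \<Rightarrow> ('c \<times> 'r \<times> 'o \<Rightarrow> nat \<Rightarrow> 'a) \<Rightarrow> bool" where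
  "optimal_rob G n s \<tau> \<longleftrightarrow>
     \<tau> \<in> rob_strategies G \<and> rob_guarantee G n s \<tau> = Min (rob_guarantee G n s ` rob_strategies G)"

definition turn_payoff ::
  "('c, 'r, 'o, 'a) gpcr \<Rightarrow> ('c \<times> 'r \<times> 'o \<Rightarrow> real) \<Rightarrow> 'c \<times> 'r \<times> 'o \<Rightarrow> 'a \<Rightarrow> real" where
  "turn_payoff G v s a =
     (\<Sum>s'\<in>states G. T_cop G s a s' *
        Min ((\<lambda>a'. \<Sum>s''\<in>states G. T_rob G s' a' s'' * v s'') ` playable_rob G s'))"

primrec w :: "('c, 'r, 'o, 'a) gpcr \<Rightarrow> nat \<Rightarrow> 'c \<times> 'r \<times> 'o \<Rightarrow> real" where
  "w G 0 s = (if s \<in> final G then 1 else 0)"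
| "w G (Suc n) s =
     (if s \<in> final G then 1 else Max (turn_payoff G (w G n) s ` playable_cop G s))"

text \<open>Where the recursion takes no maximum (at final states, or with no turn remaining), any playable
  action is allowed.\<close>

definition argmax_strategy ::
  "('c, 'r, 'o, 'a) gpcr \<Rightarrow> ('c \<times> 'r \<times> 'o \<Rightarrow> nat \<Rightarrow> 'a) \<Rightarrow> bool" where
  "argmax_strategy G \<sigma> \<longleftrightarrow>
     \<sigma> \<in> cop_strategies G \<and>
     (\<forall>s \<in> states G - final G. \<forall>k.
        is_arg_max (turn_payoff G (w G k) s) (\<lambda>a. a \<in> playable_cop G s) (\<sigma> s (Suc k)))"

text \<open>The remaining facts show that \<open>embed_pmf\<close>, \<open>Max\<close> and \<open>Min\<close> above are only applied where they
  are meaningful.\<close>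

lemma embed_pmf_finite_support:
  fixes f :: "'b \<Rightarrow> real"
  assumes "finite A" "\<And>x. x \<in> A \<Longrightarrow> 0 \<le> f x" "(\<Sum>x\<in>A. f x) = 1"
  shows "pmf (embed_pmf (\<lambda>x. if x \<in> A then f x else 0)) x = (if x \<in> A then f x else 0)"
proof (rule pmf_embed_pmf)
  show "0 \<le> (if x \<in> A then f x else 0)" for x
    using assms(2) by simp
  have "(\<integral>\<^sup>+x. ennreal (if x \<in> A then f x else 0) \<partial>count_space UNIV)
      = (\<Sum>x\<in>A. ennreal (if x \<in> A then f x else 0))"
    by (rule nn_integral_count_space') (use assms in \<open>auto split: if_splits\<close>)
  also have "\<dots> = (\<Sum>x\<in>A. ennreal (f x))"
    by (rule sum.cong) auto
  also have "\<dots> = ennreal (\<Sum>x\<in>A. f x)"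
    using assms(2) by (rule sum_ennreal)
  finally show "(\<integral>\<^sup>+x. ennreal (if x \<in> A then f x else 0) \<partial>count_space UNIV) = 1"
    using assms(3) by simp
qed

lemma pmf_cop_move:
  assumes "gpcr_game G" "s \<in> states G" "a \<in> playable_cop G s"
  shows "pmf (cop_move G s a) s' = (if s' \<in> states G then T_cop G s a s' else 0)"
  unfolding cop_move_def
  by (rule embed_pmf_finite_support) (use assms in \<open>auto simp: gpcr_game_def playable_cop_def\<close>)

lemma pmf_rob_move:
  assumes "gpcr_game G" "s \<in> states G" "a \<in> playable_rob G s"
  shows "pmf (rob_move G s a) s' = (if s' \<in> states G then T_rob G s a s' else 0)"
  unfolding rob_move_def
  by (rule embed_pmf_finite_support) (use assms in \<open>auto simp: gpcr_game_def playable_rob_def\<close>)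

lemma plays_cong:
  assumes G: "gpcr_game G" and \<sigma>: "\<sigma> \<in> cop_strategies G" and \<tau>: "\<tau> \<in> rob_strategies G"
    and eq\<sigma>: "\<And>s k. s \<in> states G \<Longrightarrow> k \<le> N \<Longrightarrow> \<sigma>' s k = \<sigma> s k"
    and eq\<tau>: "\<And>s k. s \<in> states G \<Longrightarrow> k \<le> N \<Longrightarrow> \<tau>' s k = \<tau> s k"
  shows "n \<le> N \<Longrightarrow> s \<in> states G \<Longrightarrow> plays G \<sigma>' \<tau>' n s = plays G \<sigma> \<tau> n s"
proof (induction n arbitrary: s)
  case 0
  show ?case by simp
next
  case (Suc n)
  have 1: "s' \<in> states G" if "s' \<in> set_pmf (cop_move G s (\<sigma> s (Suc n)))" for s'
    using that pmf_cop_move[OF G Suc.prems(2), of "\<sigma> s (Suc n)" s'] \<sigma> Suc.prems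
    by (auto simp: set_pmf_iff cop_strategies_def split: if_splits)
  have 2: "s'' \<in> states G"
    if "s' \<in> states G" "s'' \<in> set_pmf (rob_move G s' (\<tau> s' (Suc n)))" for s' s''
    using that pmf_rob_move[OF G that(1), of "\<tau> s' (Suc n)" s''] \<tau>
    by (auto simp: set_pmf_iff rob_strategies_def split: if_splits)
  have a: "\<sigma>' s (Suc n) = \<sigma> s (Suc n)"
    using eq\<sigma> Suc.prems by simp
  have b: "\<tau>' s' (Suc n) = \<tau> s' (Suc n)" if "s' \<in> states G" for s'
    using eq\<tau> Suc.prems that by simp
  have c: "plays G \<sigma>' \<tau>' n s'' = plays G \<sigma> \<tau> n s''" if "s'' \<in> states G" for s''
    using Suc.IH Suc.prems that by simp
  show ?case
    unfolding plays.simps a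
  proof (rule bind_pmf_cong[OF refl])
    fix s' assume "s' \<in> set_pmf (cop_move G s (\<sigma> s (Suc n)))"
    then have s': "s' \<in> states G" by (rule 1)
    show "bind_pmf (rob_move G s' (\<tau>' s' (Suc n)))
        (\<lambda>s''. map_pmf (\<lambda>h. (\<sigma> s (Suc n), s') # (\<tau>' s' (Suc n), s'') # h) (plays G \<sigma>' \<tau>' n s'')) =
      bind_pmf (rob_move G s' (\<tau> s' (Suc n)))
        (\<lambda>s''. map_pmf (\<lambda>h. (\<sigma> s (Suc n), s') # (\<tau> s' (Suc n), s'') # h) (plays G \<sigma> \<tau> n s''))"
      unfolding b[OF s']
      by (rule bind_pmf_cong[OF refl]) (simp only: c[OF 2[OF s']])
  qed
qed

lemma finite_restricted_strategies:
  fixes X :: "'s set" and A :: "'b set"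
  assumes "finite X" "finite A"
  shows "finite ((\<lambda>\<sigma> s k. if s \<in> X \<and> k \<le> n then \<sigma> s k else undefined) `
    {\<sigma> :: 's \<Rightarrow> nat \<Rightarrow> 'b. \<forall>s\<in>X. \<forall>k. \<sigma> s k \<in> A})"
proof (rule finite_subset)
  show "finite (curry ` {f. \<forall>x. (x \<in> X \<times> {..n} \<longrightarrow> f x \<in> A) \<and> (x \<notin> X \<times> {..n} \<longrightarrow> f x = undefined)})"
    using assms by (intro finite_imageI finite_set_of_finite_funs) auto
next
  show "(\<lambda>\<sigma> s k. if s \<in> X \<and> k \<le> n then \<sigma> s k else undefined) ` {\<sigma>. \<forall>s\<in>X. \<forall>k. \<sigma> s k \<in> A}
    \<subseteq> curry ` {f. \<forall>x. (x \<in> X \<times> {..n} \<longrightarrow> f x \<in> A) \<and> (x \<notin> X \<times> {..n} \<longrightarrow> f x = undefined)}"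
  proof safe
    fix \<sigma> :: "'s \<Rightarrow> nat \<Rightarrow> 'b" assume "\<forall>s\<in>X. \<forall>k. \<sigma> s k \<in> A"
    then show "(\<lambda>s k. if s \<in> X \<and> k \<le> n then \<sigma> s k else undefined) \<in>
        curry ` {f. \<forall>x. (x \<in> X \<times> {..n} \<longrightarrow> f x \<in> A) \<and> (x \<notin> X \<times> {..n} \<longrightarrow> f x = undefined)}"
      by (intro image_eqI[where x = "\<lambda>(s, k). if s \<in> X \<and> k \<le> n then \<sigma> s k else undefined"])
        (auto simp: curry_def fun_eq_iff)
  qed
qed

lemma finite_capture_probs:
  assumes G: "gpcr_game G" and s: "s \<in> states G"
  shows "finite ((\<lambda>(\<sigma>, \<tau>). capture_prob G \<sigma> \<tau> n s) ` (cop_strategies G \<times> rob_strategies G))"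
proof -
  define r where "r = (\<lambda>(\<sigma> :: 'a \<times> 'b \<times> 'c \<Rightarrow> nat \<Rightarrow> 'd) s k.
    if s \<in> states G \<and> k \<le> n then \<sigma> s k else undefined)"
  have "finite (r ` cop_strategies G)"
    unfolding r_def
    by (rule finite_subset[OF image_mono finite_restricted_strategies[of "states G" "A_cop G"]])
      (use G in \<open>auto simp: gpcr_game_def cop_strategies_def playable_cop_def\<close>)
  moreover have "finite (r ` rob_strategies G)"
    unfolding r_def
    by (rule finite_subset[OF image_mono finite_restricted_strategies[of "states G" "A_rob G"]])
      (use G in \<open>auto simp: gpcr_game_def rob_strategies_def playable_rob_def\<close>)
  ultimately have "finite ((\<lambda>(\<sigma>, \<tau>). capture_prob G \<sigma> \<tau> n s) `
      (r ` cop_strategies G \<times> r ` rob_strategies G))"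
    by blast
  moreover have "capture_prob G (r \<sigma>) (r \<tau>) n s = capture_prob G \<sigma> \<tau> n s"
    if "\<sigma> \<in> cop_strategies G" "\<tau> \<in> rob_strategies G" for \<sigma> \<tau>
    unfolding capture_prob_def
    by (subst plays_cong[OF G that, of n]) (use s in \<open>auto simp: r_def\<close>)
  then have "(\<lambda>(\<sigma>, \<tau>). capture_prob G \<sigma> \<tau> n s) ` (cop_strategies G \<times> rob_strategies G) \<subseteq>
      (\<lambda>(\<sigma>, \<tau>). capture_prob G \<sigma> \<tau> n s) ` (r ` cop_strategies G \<times> r ` rob_strategies G)"
    by (auto intro!: image_eqI[where x = "(r _, r _)"])
  ultimately show ?thesis
    by (rule finite_subset[rotated])
qed

lemma strategies_nonempty:
  assumes "gpcr_game G"
  shows "cop_strategies G \<noteq> {}" "rob_strategies G \<noteq> {}"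
proof -
  have "(\<lambda>s k. SOME a. a \<in> playable_cop G s) \<in> cop_strategies G"
    using assms by (auto simp: gpcr_game_def cop_strategies_def some_in_eq)
  then show "cop_strategies G \<noteq> {}" by blast
  have "(\<lambda>s k. SOME a. a \<in> playable_rob G s) \<in> rob_strategies G"
    using assms by (auto simp: gpcr_game_def rob_strategies_def some_in_eq)
  then show "rob_strategies G \<noteq> {}" by blast
qed

lemma finite_capture_probs_rob:
  assumes "gpcr_game G" "s \<in> states G" "\<sigma> \<in> cop_strategies G"
  shows "finite ((\<lambda>\<tau>. capture_prob G \<sigma> \<tau> n s) ` rob_strategies G)"
  by (rule finite_subset[OF _ finite_capture_probs[OF assms(1,2)]]) (use assms(3) in force)

lemma finite_capture_probs_cop:
  assumes "gpcr_game G" "s \<in> states G" "\<tau> \<in> rob_strategies G"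
  shows "finite ((\<lambda>\<sigma>. capture_prob G \<sigma> \<tau> n s) ` cop_strategies G)"
  by (rule finite_subset[OF _ finite_capture_probs[OF assms(1,2)]]) (use assms(3) in force)

lemma finite_guarantees:
  assumes "gpcr_game G" "s \<in> states G"
  shows "finite (cop_guarantee G n s ` cop_strategies G)"
    and "finite (rob_guarantee G n s ` rob_strategies G)"
proof -
  have "cop_guarantee G n s \<sigma> \<in> (\<lambda>\<tau>. capture_prob G \<sigma> \<tau> n s) ` rob_strategies G"
    if "\<sigma> \<in> cop_strategies G" for \<sigma>
    unfolding cop_guarantee_def
    using finite_capture_probs_rob[OF assms that] strategies_nonempty[OF assms(1)]
    by (intro Min_in) auto
  then show "finite (cop_guarantee G n s ` cop_strategies G)"
    by (intro finite_subset[OF _ finite_capture_probs[OF assms]]) force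
  have "rob_guarantee G n s \<tau> \<in> (\<lambda>\<sigma>. capture_prob G \<sigma> \<tau> n s) ` cop_strategies G"
    if "\<tau> \<in> rob_strategies G" for \<tau>
    unfolding rob_guarantee_def
    using finite_capture_probs_cop[OF assms that] strategies_nonempty[OF assms(1)]
    by (intro Max_in) auto
  then show "finite (rob_guarantee G n s ` rob_strategies G)"
    by (intro finite_subset[OF _ finite_capture_probs[OF assms]]) force
qed

end

theory Submission
  imports Defs
begin

text \<open>Final states are absorbing for both teams, so a play that meets \<open>F\<close> in the middle of a turn
  is still in \<open>F\<close> at the end of that turn. Hence capture probabilities satisfy a one-turn recursion
  of the same shape as that of \<open>w\<close>. Induction on the number of turns then shows that an argmax
  strategy of the cops secures at least \<open>w\<close> and an argmin strategy of the robbers concedes at most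
  \<open>w\<close>, so the two form a saddle point.\<close>

section \<open>The robbers' half of a turn, and basic facts on playable actions\<close>

text \<open>Isolating the inner sum of \<open>turn_payoff\<close> lets the same expression be used
  with two continuation values: \<open>w G n\<close> and the capture probability of a fixed strategy
  pair.\<close>

definition rob_payoff ::
  "('c, 'r, 'o, 'a) gpcr \<Rightarrow> ('c \<times> 'r \<times> 'o \<Rightarrow> real) \<Rightarrow> 'c \<times> 'r \<times> 'o \<Rightarrow> 'a \<Rightarrow> real" where
  "rob_payoff G v s a = (\<Sum>s'\<in>states G. T_rob G s a s' * v s')"

lemma turn_payoff_eq:
  "turn_payoff G v s a = (\<Sum>s'\<in>states G. T_cop G s a s' * Min (rob_payoff G v s' ` playable_rob G s'))"
  by (simp add: turn_payoff_def rob_payoff_def[abs_def])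

lemma finite_playable:
  assumes "gpcr_game G"
  shows "finite (playable_cop G s)" "finite (playable_rob G s)"
  using assms by (auto simp: gpcr_game_def playable_cop_def playable_rob_def)

lemma playable_nonempty:
  assumes "gpcr_game G" "s \<in> states G"
  shows "playable_cop G s \<noteq> {}" "playable_rob G s \<noteq> {}"
  using assms by (auto simp: gpcr_game_def)

lemma T_cop_nonneg:
  assumes "gpcr_game G" "s \<in> states G" "a \<in> playable_cop G s" "s' \<in> states G"
  shows "0 \<le> T_cop G s a s'"
  using assms by (auto simp: gpcr_game_def playable_cop_def)

lemma T_rob_nonneg:
  assumes "gpcr_game G" "s \<in> states G" "a \<in> playable_rob G s" "s' \<in> states G"
  shows "0 \<le> T_rob G s a s'"
  using assms by (auto simp: gpcr_game_def playable_rob_def)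

lemma rob_payoff_mono:
  assumes "gpcr_game G" "s \<in> states G" "a \<in> playable_rob G s"
    and "\<And>s'. s' \<in> states G \<Longrightarrow> v s' \<le> v' s'"
  shows "rob_payoff G v s a \<le> rob_payoff G v' s a"
  unfolding rob_payoff_def using assms by (intro sum_mono mult_left_mono T_rob_nonneg)

section \<open>Expectations over moves and the one-turn recursion for capture probabilities\<close>

text \<open>The support of the move lies in the finite set \<open>states G\<close>, where its mass
  function is the transition function, so the integral reduces to a finite sum.\<close>

lemma expectation_cop_move:
  fixes f :: "'c \<times> 'r \<times> 'o \<Rightarrow> real"
  assumes G: "gpcr_game (G :: ('c, 'r, 'o, 'a) gpcr)" "s \<in> states G" "a \<in> playable_cop G s"
  shows "measure_pmf.expectation (cop_move G s a) f = (\<Sum>s'\<in>states G. T_cop G s a s' * f s')"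
  by (subst integral_measure_pmf_real[where A = "states G"])
    (use G in \<open>auto simp: gpcr_game_def[of G] set_pmf_iff pmf_cop_move[OF G] split: if_splits
      intro!: sum.cong\<close>)

lemma expectation_rob_move:
  fixes f :: "'c \<times> 'r \<times> 'o \<Rightarrow> real"
  assumes G: "gpcr_game (G :: ('c, 'r, 'o, 'a) gpcr)" "s \<in> states G" "a \<in> playable_rob G s"
  shows "measure_pmf.expectation (rob_move G s a) f = rob_payoff G f s a"
  unfolding rob_payoff_def
  by (subst integral_measure_pmf_real[where A = "states G"])
    (use G in \<open>auto simp: gpcr_game_def[of G] set_pmf_iff pmf_rob_move[OF G] split: if_splits
      intro!: sum.cong\<close>)

text \<open>The self-loop at a final state carries mass 1, which leaves no other point in the
  support.\<close>

lemma rob_move_final: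
  assumes G: "gpcr_game G" and s: "s \<in> final G" and a: "a \<in> playable_rob G s"
  shows "rob_move G s a = return_pmf s"
proof -
  have s': "s \<in> states G" and T: "T_rob G s a s = 1"
    using assms by (auto simp: gpcr_game_def playable_rob_def)
  then have "pmf (rob_move G s a) s = 1"
    by (simp add: pmf_rob_move[OF G s' a])
  then show ?thesis
    by (metis measure_pmf_single measure_pmf.prob_eq_1 AE_measure_pmf_iff set_pmf_subset_singleton
        subsetI singleton_iff sets_measure_pmf UNIV_I)
qed

lemma capture_prob_final:
  assumes "s \<in> final G"
  shows "capture_prob G \<sigma> \<tau> n s = 1"
  using assms measure_pmf.prob_space by (simp add: capture_prob_def)

lemma capture_prob_0:
  "capture_prob G \<sigma> \<tau> 0 s = w G 0 s"
  by (simp add: capture_prob_def)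

text \<open>Law of total probability, carried over from nonnegative integrals: the integrand is
  bounded by 1, hence integrable.\<close>

lemma measure_bind_pmf:
  "measure_pmf.prob (bind_pmf p f) X = measure_pmf.expectation p (\<lambda>x. measure_pmf.prob (f x) X)"
proof -
  have "ennreal (measure_pmf.prob (bind_pmf p f) X) = (\<integral>\<^sup>+x. ennreal (measure_pmf.prob (f x) X) \<partial>p)"
    by (simp add: measure_pmf.emeasure_eq_measure[symmetric] emeasure_bind_pmf)
  also have "\<dots> = ennreal (measure_pmf.expectation p (\<lambda>x. measure_pmf.prob (f x) X))"
    by (intro nn_integral_eq_integral measure_pmf.integrable_const_bound[where B = 1]) auto
  finally show ?thesis
    by (subst (asm) ennreal_inj) (auto intro!: integral_nonneg)
qed

text \<open>Conditioning on both moves of the first turn leaves the tail of the play from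
  \<open>s''\<close>. Since \<open>s\<close> is not final, capture in the whole play amounts to
  capture in that tail.\<close>

lemma capture_prob_Suc:
  assumes G: "gpcr_game G" and \<sigma>: "\<sigma> \<in> cop_strategies G" and \<tau>: "\<tau> \<in> rob_strategies G"
    and s: "s \<in> states G" "s \<notin> final G"
  shows "capture_prob G \<sigma> \<tau> (Suc n) s =
    (\<Sum>s'\<in>states G. T_cop G s (\<sigma> s (Suc n)) s' *
       rob_payoff G (capture_prob G \<sigma> \<tau> n) s' (\<tau> s' (Suc n)))"
proof -
  let ?C = "{h. \<exists>t \<in> insert s (snd ` set h). t \<in> final G}"
  have a: "\<sigma> s (Suc n) \<in> playable_cop G s"
    using \<sigma> s by (simp add: cop_strategies_def)
  have b: "\<tau> s' (Suc n) \<in> playable_rob G s'" if "s' \<in> states G" for s'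
    using \<tau> that by (simp add: rob_strategies_def)
  have step: "measure_pmf.prob (bind_pmf (rob_move G s' (\<tau> s' (Suc n))) (\<lambda>s''.
      map_pmf (\<lambda>h. (\<sigma> s (Suc n), s') # (\<tau> s' (Suc n), s'') # h) (plays G \<sigma> \<tau> n s''))) ?C
      = rob_payoff G (capture_prob G \<sigma> \<tau> n) s' (\<tau> s' (Suc n))" (is "?L = _")
    if s': "s' \<in> states G" for s'
  proof -
    have "?L = measure_pmf.expectation (rob_move G s' (\<tau> s' (Suc n))) (capture_prob G \<sigma> \<tau> n)"
      unfolding measure_bind_pmf
    proof (rule integral_cong_AE)
      show "AE s'' in rob_move G s' (\<tau> s' (Suc n)).
        measure_pmf.prob (map_pmf (\<lambda>h. (\<sigma> s (Suc n), s') # (\<tau> s' (Suc n), s'') # h)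
          (plays G \<sigma> \<tau> n s'')) ?C = capture_prob G \<sigma> \<tau> n s''"
        unfolding AE_measure_pmf_iff
      proof
        fix s'' assume s'': "s'' \<in> set_pmf (rob_move G s' (\<tau> s' (Suc n)))"
        \<comment> \<open>absorption: capture at \<open>s'\<close> in the middle of the turn is still visible at \<open>s''\<close>\<close>
        have "s'' \<in> final G" if "s' \<in> final G"
          using s'' that by (simp add: rob_move_final[OF G that b[OF s']])
        then have "(\<lambda>h. (\<sigma> s (Suc n), s') # (\<tau> s' (Suc n), s'') # h) -` ?C =
            {h. \<exists>t \<in> insert s'' (snd ` set h). t \<in> final G}"
          using s by auto
        then show "measure_pmf.prob (map_pmf (\<lambda>h. (\<sigma> s (Suc n), s') # (\<tau> s' (Suc n), s'') # h)
            (plays G \<sigma> \<tau> n s'')) ?C = capture_prob G \<sigma> \<tau> n s''"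
          by (simp only: measure_map_pmf capture_prob_def)
      qed
    qed simp_all
    then show ?thesis
      by (simp add: expectation_rob_move[OF G s' b[OF s']])
  qed
  show ?thesis
    unfolding capture_prob_def[of G \<sigma> \<tau> "Suc n"] plays.simps
    \<comment> \<open>\<open>step\<close> is only available for \<open>s'\<close> in
      \<open>states G\<close>; \<open>sum.cong\<close> supplies this membership under the
      sum.\<close>
    by (subst measure_bind_pmf) (simp only: expectation_cop_move[OF G s(1) a] step cong: sum.cong)
qed

section \<open>Argmax and argmin strategies compared with \<open>w\<close>\<close>

lemma argmax_strategy_exists:
  assumes G: "gpcr_game G"
  shows "\<exists>\<sigma>. argmax_strategy G \<sigma>"
proof -
  have "\<exists>a. is_arg_max (turn_payoff G (w G k) s) (\<lambda>a. a \<in> playable_cop G s) a"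
    if "s \<in> states G" for s k
    \<comment> \<open>A maximizer is obtained as a minimizer of the negated payoff.\<close>
    using ex_is_arg_min_if_finite[OF finite_playable(1)[OF G] playable_nonempty(1)[OF G that],
      of "\<lambda>a. - turn_payoff G (w G k) s a"]
    by (auto simp: is_arg_min_def is_arg_max_def)
  then obtain f where f: "\<And>s k. s \<in> states G \<Longrightarrow>
      is_arg_max (turn_payoff G (w G k) s) (\<lambda>a. a \<in> playable_cop G s) (f s k)"
    by metis
  \<comment> \<open>The shift matches the \<open>Suc k\<close> in \<open>argmax_strategy\<close>; at
    \<open>k = 0\<close>, truncated subtraction yields \<open>f s 0\<close>, which is still
    playable.\<close>
  then have "argmax_strategy G (\<lambda>s k. f s (k - 1))"
    by (auto simp: argmax_strategy_def cop_strategies_def is_arg_max_def)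
  then show ?thesis by blast
qed

text \<open>The argmax action attains the maximum in \<open>w\<close>, and the inner minimum is at
  most the payoff of the reply actually played. As strategies are indexed by the turns remaining,
  the same pair governs the tail, so the induction generalizes only \<open>s\<close>.\<close>

lemma argmax_strategy_ge_w:
  assumes G: "gpcr_game G" and \<sigma>: "argmax_strategy G \<sigma>" and \<tau>: "\<tau> \<in> rob_strategies G"
    and "s \<in> states G"
  shows "w G n s \<le> capture_prob G \<sigma> \<tau> n s"
  using \<open>s \<in> states G\<close>
proof (induction n arbitrary: s)
  case 0
  show ?case by (simp only: capture_prob_0)
next
  case (Suc n)
  show ?case
  proof (cases "s \<in> final G")
    case True
    then show ?thesis by (simp add: capture_prob_final)
  next
    case False
    let ?a = "\<sigma> s (Suc n)"
    have \<sigma>': "\<sigma> \<in> cop_strategies G"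
      and am: "is_arg_max (turn_payoff G (w G n) s) (\<lambda>a. a \<in> playable_cop G s) ?a"
      using \<sigma> Suc.prems False by (auto simp: argmax_strategy_def)
    have "w G (Suc n) s = turn_payoff G (w G n) s ?a"
      using am False finite_playable(1)[OF G, of s]
      by (auto simp: is_arg_max_def not_less intro!: Max_eqI)
    also have "\<dots> \<le> capture_prob G \<sigma> \<tau> (Suc n) s"
      unfolding capture_prob_Suc[OF G \<sigma>' \<tau> Suc.prems False] turn_payoff_eq
    proof (intro sum_mono mult_left_mono)
      fix s' assume s': "s' \<in> states G"
      then have b: "\<tau> s' (Suc n) \<in> playable_rob G s'"
        using \<tau> by (simp add: rob_strategies_def)
      then have "Min (rob_payoff G (w G n) s' ` playable_rob G s') \<le>
          rob_payoff G (w G n) s' (\<tau> s' (Suc n))"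
        using finite_playable(2)[OF G] by (intro Min_le) auto
      also have "\<dots> \<le> rob_payoff G (capture_prob G \<sigma> \<tau> n) s' (\<tau> s' (Suc n))"
        using Suc.IH by (rule rob_payoff_mono[OF G s' b])
      finally show "Min (rob_payoff G (w G n) s' ` playable_rob G s') \<le>
          rob_payoff G (capture_prob G \<sigma> \<tau> n) s' (\<tau> s' (Suc n))" .
      show "0 \<le> T_cop G s ?a s'"
        using am s' Suc.prems G by (intro T_cop_nonneg) (auto simp: is_arg_max_def)
    qed
    finally show ?thesis .
  qed
qed

text \<open>The minimum inside \<open>turn_payoff\<close> is taken at every state \<open>s'\<close>
  reached by the cops, so, unlike in \<open>argmax_strategy\<close>, final states are
  included.\<close>

definition argmin_strategy ::
  "('c, 'r, 'o, 'a) gpcr \<Rightarrow> ('c \<times> 'r \<times> 'o \<Rightarrow> nat \<Rightarrow> 'a) \<Rightarrow> bool" where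
  "argmin_strategy G \<tau> \<longleftrightarrow>
     \<tau> \<in> rob_strategies G \<and>
     (\<forall>s \<in> states G. \<forall>k.
        is_arg_min (rob_payoff G (w G k) s) (\<lambda>a. a \<in> playable_rob G s) (\<tau> s (Suc k)))"

lemma argmin_strategy_exists:
  assumes G: "gpcr_game G"
  shows "\<exists>\<tau>. argmin_strategy G \<tau>"
proof -
  have "\<exists>a. is_arg_min (rob_payoff G (w G k) s) (\<lambda>a. a \<in> playable_rob G s) a"
    if "s \<in> states G" for s k
    using ex_is_arg_min_if_finite[OF finite_playable(2)[OF G] playable_nonempty(2)[OF G that]]
    by blast
  then obtain f where f: "\<And>s k. s \<in> states G \<Longrightarrow>
      is_arg_min (rob_payoff G (w G k) s) (\<lambda>a. a \<in> playable_rob G s) (f s k)"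
    by metis
  then have "argmin_strategy G (\<lambda>s k. f s (k - 1))"
    by (auto simp: argmin_strategy_def rob_strategies_def is_arg_min_def)
  then show ?thesis by blast
qed

text \<open>Dually, the argmin reply attains the inner minimum, and the action chosen by the cops
  yields at most the maximum.\<close>

lemma argmin_strategy_le_w:
  assumes G: "gpcr_game G" and \<sigma>: "\<sigma> \<in> cop_strategies G" and \<tau>: "argmin_strategy G \<tau>"
    and "s \<in> states G"
  shows "capture_prob G \<sigma> \<tau> n s \<le> w G n s"
  using \<open>s \<in> states G\<close>
proof (induction n arbitrary: s)
  case 0
  show ?case by (simp only: capture_prob_0)
next
  case (Suc n)
  show ?case
  proof (cases "s \<in> final G")
    case True
    then show ?thesis by (simp add: capture_prob_final)
  next
    case False
    let ?a = "\<sigma> s (Suc n)"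
    have \<tau>': "\<tau> \<in> rob_strategies G"
      using \<tau> by (simp add: argmin_strategy_def)
    have a: "?a \<in> playable_cop G s"
      using \<sigma> Suc.prems by (simp add: cop_strategies_def)
    have "capture_prob G \<sigma> \<tau> (Suc n) s \<le> turn_payoff G (w G n) s ?a"
      unfolding capture_prob_Suc[OF G \<sigma> \<tau>' Suc.prems False] turn_payoff_eq
    proof (intro sum_mono mult_left_mono)
      fix s' assume s': "s' \<in> states G"
      then have am: "is_arg_min (rob_payoff G (w G n) s') (\<lambda>a. a \<in> playable_rob G s') (\<tau> s' (Suc n))"
        using \<tau> by (simp add: argmin_strategy_def)
      then have b: "\<tau> s' (Suc n) \<in> playable_rob G s'"
        by (simp add: is_arg_min_def)
      have "rob_payoff G (capture_prob G \<sigma> \<tau> n) s' (\<tau> s' (Suc n)) \<le>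
          rob_payoff G (w G n) s' (\<tau> s' (Suc n))"
        using Suc.IH by (rule rob_payoff_mono[OF G s' b])
      also have "\<dots> = Min (rob_payoff G (w G n) s' ` playable_rob G s')"
        using am finite_playable(2)[OF G, of s']
        by (auto simp: is_arg_min_def not_less intro!: Min_eqI[symmetric])
      finally show "rob_payoff G (capture_prob G \<sigma> \<tau> n) s' (\<tau> s' (Suc n)) \<le>
          Min (rob_payoff G (w G n) s' ` playable_rob G s')" .
      show "0 \<le> T_cop G s ?a s'"
        using T_cop_nonneg[OF G Suc.prems a s'] .
    qed
    also have "\<dots> \<le> w G (Suc n) s"
      using a False finite_playable(1)[OF G] by (auto intro!: Max_ge)
    finally show ?thesis .
  qed
qed

section \<open>Guarantees, the saddle point and the value of the game\<close>

lemma cop_guarantee_le: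
  assumes "gpcr_game G" "s \<in> states G" "\<sigma> \<in> cop_strategies G" "\<tau> \<in> rob_strategies G"
  shows "cop_guarantee G n s \<sigma> \<le> capture_prob G \<sigma> \<tau> n s"
  unfolding cop_guarantee_def using assms by (intro Min_le finite_capture_probs_rob) auto

lemma rob_guarantee_ge:
  assumes "gpcr_game G" "s \<in> states G" "\<sigma> \<in> cop_strategies G" "\<tau> \<in> rob_strategies G"
  shows "capture_prob G \<sigma> \<tau> n s \<le> rob_guarantee G n s \<tau>"
  unfolding rob_guarantee_def using assms by (intro Max_ge finite_capture_probs_cop) auto

text \<open>A single argmin strategy of the robbers holds every cop strategy down to
  \<open>w\<close>.\<close>

lemma cop_guarantee_le_w:
  assumes G: "gpcr_game G" and s: "s \<in> states G" and \<sigma>: "\<sigma> \<in> cop_strategies G"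
  shows "cop_guarantee G n s \<sigma> \<le> w G n s"
proof -
  obtain \<tau> where \<tau>: "argmin_strategy G \<tau>"
    using argmin_strategy_exists[OF G] ..
  then have "cop_guarantee G n s \<sigma> \<le> capture_prob G \<sigma> \<tau> n s"
    by (intro cop_guarantee_le[OF G s \<sigma>]) (simp add: argmin_strategy_def)
  also have "\<dots> \<le> w G n s"
    by (rule argmin_strategy_le_w[OF G \<sigma> \<tau> s])
  finally show ?thesis .
qed

lemma rob_guarantee_ge_w:
  assumes G: "gpcr_game G" and s: "s \<in> states G" and \<tau>: "\<tau> \<in> rob_strategies G"
  shows "w G n s \<le> rob_guarantee G n s \<tau>"
proof -
  obtain \<sigma> where \<sigma>: "argmax_strategy G \<sigma>"
    using argmax_strategy_exists[OF G] ..
  then have "w G n s \<le> capture_prob G \<sigma> \<tau> n s"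
    by (rule argmax_strategy_ge_w[OF G _ \<tau> s])
  also have "\<dots> \<le> rob_guarantee G n s \<tau>"
    using \<sigma> by (intro rob_guarantee_ge[OF G s _ \<tau>]) (simp add: argmax_strategy_def)
  finally show ?thesis .
qed

lemma cop_guarantee_argmax_strategy:
  assumes G: "gpcr_game G" and s: "s \<in> states G" and \<sigma>: "argmax_strategy G \<sigma>"
  shows "cop_guarantee G n s \<sigma> = w G n s"
proof (rule antisym)
  have \<sigma>': "\<sigma> \<in> cop_strategies G"
    using \<sigma> by (simp add: argmax_strategy_def)
  then show "cop_guarantee G n s \<sigma> \<le> w G n s"
    by (rule cop_guarantee_le_w[OF G s])
  show "w G n s \<le> cop_guarantee G n s \<sigma>"
    unfolding cop_guarantee_def
    using finite_capture_probs_rob[OF G s \<sigma>'] strategies_nonempty(2)[OF G]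
      argmax_strategy_ge_w[OF G \<sigma> _ s]
    by (intro Min.boundedI) auto
qed

lemma rob_guarantee_argmin_strategy:
  assumes G: "gpcr_game G" and s: "s \<in> states G" and \<tau>: "argmin_strategy G \<tau>"
  shows "rob_guarantee G n s \<tau> = w G n s"
proof (rule antisym)
  have \<tau>': "\<tau> \<in> rob_strategies G"
    using \<tau> by (simp add: argmin_strategy_def)
  then show "w G n s \<le> rob_guarantee G n s \<tau>"
    by (rule rob_guarantee_ge_w[OF G s])
  show "rob_guarantee G n s \<tau> \<le> w G n s"
    unfolding rob_guarantee_def
    using finite_capture_probs_cop[OF G s \<tau>'] strategies_nonempty(1)[OF G]
      argmin_strategy_le_w[OF G _ \<tau> s]
    by (intro Max.boundedI) auto
qed

text \<open>\<open>w\<close> bounds all cop guarantees from above, and an argmax strategy attains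
  this bound.\<close>

lemma max_min_value_eq_w:
  assumes G: "gpcr_game G" and s: "s \<in> states G"
  shows "max_min_value G n s = w G n s"
proof -
  obtain \<sigma> where \<sigma>: "argmax_strategy G \<sigma>"
    using argmax_strategy_exists[OF G] ..
  then have "w G n s \<in> cop_guarantee G n s ` cop_strategies G"
    using cop_guarantee_argmax_strategy[OF G s \<sigma>, of n]
    by (intro image_eqI[where x = \<sigma>]) (auto simp: argmax_strategy_def)
  then show ?thesis
    unfolding max_min_value_def
    using finite_guarantees(1)[OF G s] cop_guarantee_le_w[OF G s]
    by (intro Max_eqI) auto
qed

text \<open>Together with \<open>max_min_value_eq_w\<close> this is the minimax equality; it ties
  \<open>optimal_rob\<close>, which is defined through the min-max value, to
  \<open>w\<close>.\<close>

lemma min_max_value_eq_w: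
  assumes G: "gpcr_game G" and s: "s \<in> states G"
  shows "Min (rob_guarantee G n s ` rob_strategies G) = w G n s"
proof -
  obtain \<tau> where \<tau>: "argmin_strategy G \<tau>"
    using argmin_strategy_exists[OF G] ..
  then have "w G n s \<in> rob_guarantee G n s ` rob_strategies G"
    using rob_guarantee_argmin_strategy[OF G s \<tau>, of n]
    by (intro image_eqI[where x = \<tau>]) (auto simp: argmin_strategy_def)
  then show ?thesis
    using finite_guarantees(2)[OF G s] rob_guarantee_ge_w[OF G s]
    by (intro Min_eqI) auto
qed

text \<open>The optimal strategies are arbitrary here, not necessarily of argmax or argmin form.
  Both of their guarantees equal \<open>w\<close>, and the capture probability lies between the
  two.\<close>

lemma capture_prob_optimal:
  assumes G: "gpcr_game G" and s: "s \<in> states G"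
    and \<sigma>: "optimal_cop G n s \<sigma>" and \<tau>: "optimal_rob G n s \<tau>"
  shows "capture_prob G \<sigma> \<tau> n s = w G n s"
proof (rule antisym)
  have \<sigma>': "\<sigma> \<in> cop_strategies G" "cop_guarantee G n s \<sigma> = w G n s"
    using \<sigma> by (auto simp: optimal_cop_def max_min_value_eq_w[OF G s])
  have \<tau>': "\<tau> \<in> rob_strategies G" "rob_guarantee G n s \<tau> = w G n s"
    using \<tau> by (auto simp: optimal_rob_def min_max_value_eq_w[OF G s])
  show "capture_prob G \<sigma> \<tau> n s \<le> w G n s"
    using rob_guarantee_ge[OF G s \<sigma>'(1) \<tau>'(1), of n] \<tau>'(2) by simp
  show "w G n s \<le> capture_prob G \<sigma> \<tau> n s"
    using cop_guarantee_le[OF G s \<sigma>'(1) \<tau>'(1), of n] \<sigma>'(2) by simp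
qed

theorem theorem1:
  fixes G :: "('c, 'r, 'o, 'a) gpcr"
  assumes "gpcr_game G"
  shows "(\<forall>n. \<forall>s\<in>states G. w G n s = max_min_value G n s) \<and>
    (\<forall>n. \<forall>s\<in>states G. \<forall>\<sigma> \<tau>. optimal_cop G n s \<sigma> \<and> optimal_rob G n s \<tau> \<longrightarrow>
       capture_prob G \<sigma> \<tau> n s = w G n s) \<and>
    (\<forall>n. w G n (init G) = p_star G n) \<and>
    (\<forall>n p. copwin G p n \<longleftrightarrow> w G n (init G) \<ge> p) \<and>
    (\<exists>\<sigma>. argmax_strategy G \<sigma>) \<and>
    (\<forall>\<sigma>. argmax_strategy G \<sigma> \<longrightarrow> (\<forall>n. optimal_cop G n (init G) \<sigma>))"
proof -
  have i: "init G \<in> states G"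
    using assms by (simp add: gpcr_game_def)
  \<comment> \<open>\<open>argmax_strategy\<close> does not mention the horizon, so one
    \<open>\<sigma>\<close> is optimal for every \<open>n\<close>.\<close>
  have "optimal_cop G n (init G) \<sigma>" if "argmax_strategy G \<sigma>" for n \<sigma>
    using that cop_guarantee_argmax_strategy[OF assms i that, of n]
    by (simp add: optimal_cop_def argmax_strategy_def max_min_value_eq_w[OF assms i])
  then show ?thesis
    using max_min_value_eq_w[OF assms] capture_prob_optimal[OF assms]
      argmax_strategy_exists[OF assms] i
    by (auto simp: p_star_def copwin_def)
qed

end
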